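(* Let $R$ be a reduced commutative ring with identity having exactly $n$ minimal prime ideals, where $3\le n<\infty$, and assume $\alpha_{\max}\ge 2$. Then $\kappa(W\Gamma(R))=\delta(W\Gamma(R))$.
   Context: Weakly zero-divisor graph: for a commutative ring $R$ with identity, $Z(R)$ is the set of zero-divisors (elements $x$ with $xy=0$ for some $y\ne 0$), $Z(R)^*=Z(R)\setminus\{0\}$, and $\mathrm{ann}(x)=\{r\in R: rx=0\}$. $W\Gamma(R)$ is the simple undirected graph with vertex set $Z(R)^*$ in which two distinct vertices $x,y$ are adjacent if and only if there exist nonzero $w\in\mathrm{ann}(x)$ and nonzero $z\in\mathrm{ann}(y)$ with $wz=0$. Minimal primes: $\mathrm{Min}(R)=\{\mathfrak p_1,\dots,\mathfrak p_n\}$ is the set of minimal prime ideals of $R$. For $1\le i\le n$, $\gamma_i:=\mathfrak p_i\setminus\bigcup_{j\ne i}\mathfrak p_j$, and $\alpha_{\max}:=\max\{|\gamma_i|:1\le i\le n\}$. Graph notions: a cut-set of a connected graph $\Gamma$ is a set $A\subseteq V(\Gamma)$ such that there are distinct vertices $x,y\in V(\Gamma)\setminus A$ with every path from $x$ to $y$ meeting $A$, and no proper subset of $A$ has this property. $\kappa(\Gamma)$ (vertex connectivity) is the smallest cardinality of a cut-set. $\deg(v)$ is the cardinality of the set of neighbours of $v$, and $\delta(\Gamma)=\min\{\deg(v): v\in V(\Gamma)\}$. *)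

theory Defs
  imports "HOL-Algebra.Ideal" "Graph_Theory.Graph_Theory"
begin

unbundle cardinal_syntax

section \<open>Least and greatest cardinals\<close>

text \<open>
  The ring may be infinite, so sizes are cardinals in the sense of the HOL library: cardinal
  orders \<open>|A|\<close>, compared with \<open>\<le>o\<close> and identified by \<open>=o\<close>.
  The two choices below determine a cardinal up to \<open>=o\<close> whenever the least or greatest
  element exists.
\<close>

definition least_card :: "'a rel set \<Rightarrow> 'a rel" where
  "least_card K = (SOME r. r \<in> K \<and> (\<forall>s\<in>K. r \<le>o s))"

definition greatest_card :: "'a rel set \<Rightarrow> 'a rel" where
  "greatest_card K = (SOME r. r \<in> K \<and> (\<forall>s\<in>K. s \<le>o r))"

lemma least_card:
  assumes "K \<noteq> {}" and "\<And>r. r \<in> K \<Longrightarrow> Card_order r"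
  shows "least_card K \<in> K" and "\<And>s. s \<in> K \<Longrightarrow> least_card K \<le>o s"
proof -
  have "\<exists>r. r \<in> K \<and> (\<forall>s\<in>K. r \<le>o s)"
    using exists_minim_Card_order[of K] assms by blast
  from someI_ex[OF this] show "least_card K \<in> K" and "\<And>s. s \<in> K \<Longrightarrow> least_card K \<le>o s"
    unfolding least_card_def by blast+
qed

lemma greatest_card:
  assumes "finite K" and "K \<noteq> {}" and "\<And>r. r \<in> K \<Longrightarrow> Card_order r"
  shows "greatest_card K \<in> K" and "\<And>s. s \<in> K \<Longrightarrow> s \<le>o greatest_card K"
proof -
  have "\<exists>r. r \<in> K \<and> (\<forall>s\<in>K. s \<le>o r)"
    using assms
  proof (induction K rule: finite_ne_induct)
    case (singleton x)
    then show ?case by (auto intro: ordLeq_refl)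
  next
    case (insert x F)
    then obtain r where r: "r \<in> F" "\<forall>s\<in>F. s \<le>o r" by auto
    have c: "Card_order x" "Card_order r" using insert.prems r by auto
    then have "Well_order x" "Well_order r"
      by (auto simp: card_order_on_def)
    then consider "x \<le>o r" | "r \<le>o x" using ordLeq_total by blast
    then show ?case
    proof cases
      case 1
      then show ?thesis using r by auto
    next
      case 2
      then have "\<forall>s\<in>insert x F. s \<le>o x"
        using r c by (auto intro: ordLeq_transitive ordLeq_refl)
      then show ?thesis by blast
    qed
  qed
  from someI_ex[OF this] show "greatest_card K \<in> K" and "\<And>s. s \<in> K \<Longrightarrow> s \<le>o greatest_card K"
    unfolding greatest_card_def by blast+
qed

section \<open>Rings\<close>

definition zero_divisors :: "('a, 'm) ring_scheme \<Rightarrow> 'a set" where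
  "zero_divisors R =
    {x \<in> carrier R. \<exists>y\<in>carrier R. y \<noteq> \<zero>\<^bsub>R\<^esub> \<and> x \<otimes>\<^bsub>R\<^esub> y = \<zero>\<^bsub>R\<^esub>}"

definition ann :: "('a, 'm) ring_scheme \<Rightarrow> 'a \<Rightarrow> 'a set" where
  "ann R x = {r \<in> carrier R. r \<otimes>\<^bsub>R\<^esub> x = \<zero>\<^bsub>R\<^esub>}"

definition reduced_ring :: "('a, 'm) ring_scheme \<Rightarrow> bool" where
  "reduced_ring R \<longleftrightarrow>
    (\<forall>x\<in>carrier R. \<forall>k::nat. x [^]\<^bsub>R\<^esub> k = \<zero>\<^bsub>R\<^esub> \<longrightarrow> x = \<zero>\<^bsub>R\<^esub>)"

definition minimal_primes :: "('a, 'm) ring_scheme \<Rightarrow> 'a set set" where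
  "minimal_primes R =
    {P. primeideal P R \<and> (\<forall>Q. primeideal Q R \<and> Q \<subseteq> P \<longrightarrow> Q = P)}"

definition gamma_part :: "('a, 'm) ring_scheme \<Rightarrow> 'a set \<Rightarrow> 'a set" where
  "gamma_part R P = P - \<Union> (minimal_primes R - {P})"

definition alpha_max :: "('a, 'm) ring_scheme \<Rightarrow> 'a rel" where
  "alpha_max R = greatest_card {|gamma_part R P| | P. P \<in> minimal_primes R}"

section \<open>Graphs\<close>

text \<open>
  An undirected simple graph is a loop-free digraph without parallel arcs whose arc relation
  is symmetric; it need not be finite.
\<close>

definition separates :: "'a pair_pre_digraph \<Rightarrow> 'a set \<Rightarrow> bool" where
  "separates G A \<longleftrightarrow> A \<subseteq> pverts G \<and>
    (\<exists>x\<in>pverts G - A. \<exists>y\<in>pverts G - A. x \<noteq> y \<and>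
      (\<forall>p. pre_digraph.apath (with_proj G) x p y \<longrightarrow>
        set (pre_digraph.awalk_verts (with_proj G) x p) \<inter> A \<noteq> {}))"

definition cut_set :: "'a pair_pre_digraph \<Rightarrow> 'a set \<Rightarrow> bool" where
  "cut_set G A \<longleftrightarrow>
    connected (with_proj G) \<and> separates G A \<and> (\<forall>B. B \<subset> A \<longrightarrow> \<not> separates G B)"

definition vertex_connectivity :: "'a pair_pre_digraph \<Rightarrow> 'a rel" where
  "vertex_connectivity G = least_card {|A| | A. cut_set G A}"

text \<open>The library's degrees are natural numbers and vanish at vertices of infinite degree.\<close>

definition vertex_degree :: "'a pair_pre_digraph \<Rightarrow> 'a \<Rightarrow> 'a rel" where
  "vertex_degree G v = |{u \<in> pverts G. (v, u) \<in> parcs G}|"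

definition min_degree :: "'a pair_pre_digraph \<Rightarrow> 'a rel" where
  "min_degree G = least_card {vertex_degree G v | v. v \<in> pverts G}"

definition weakly_zero_divisor_graph :: "('a, 'm) ring_scheme \<Rightarrow> 'a pair_pre_digraph" where
  "weakly_zero_divisor_graph R =
    \<lparr>pverts = zero_divisors R - {\<zero>\<^bsub>R\<^esub>},
     parcs = {(x, y). x \<in> zero_divisors R - {\<zero>\<^bsub>R\<^esub>} \<and> y \<in> zero_divisors R - {\<zero>\<^bsub>R\<^esub>} \<and> x \<noteq> y \<and>
       (\<exists>w\<in>ann R x. \<exists>z\<in>ann R y.
          w \<noteq> \<zero>\<^bsub>R\<^esub> \<and> z \<noteq> \<zero>\<^bsub>R\<^esub> \<and> w \<otimes>\<^bsub>R\<^esub> z = \<zero>\<^bsub>R\<^esub>)}\<rparr>"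

lemma weakly_zero_divisor_graph_simple:
  assumes "cring R"
  shows "pair_bidirected_digraph (weakly_zero_divisor_graph R)"
proof -
  interpret cring R by fact
  have mc: "w \<otimes>\<^bsub>R\<^esub> z = \<zero>\<^bsub>R\<^esub> \<Longrightarrow> z \<otimes>\<^bsub>R\<^esub> w = \<zero>\<^bsub>R\<^esub>"
    if "w \<in> ann R x" "z \<in> ann R y" for w z x y
    using that m_comm by (auto simp: ann_def)
  show ?thesis
  proof (unfold_locales, goal_cases)
    case 3
    show ?case
      unfolding symmetric_def sym_def with_proj_simps
      using mc by (fastforce simp: weakly_zero_divisor_graph_def)
  qed (auto simp: weakly_zero_divisor_graph_def)
qed

end

theory Submission
  imports Defs
begin

text \<open>
  The graph of the theorem is complete multipartite, and for such graphs both invariants can be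
  read off.

  In a reduced ring the minimal primes intersect in \<open>0\<close> (\<open>ex_minimal_prime_avoiding\<close>), so a
  product vanishes exactly when every minimal prime contains one of the factors
  (\<open>mult_eq_zero_iff\<close>). As there are finitely many minimal primes, each minimal prime \<open>P\<close> has a
  companion \<open>e\<^sub>P\<close> that lies in all minimal primes except \<open>P\<close>
  (\<open>ex_in_other_minimal_primes\<close>). If \<open>x \<in> P\<close> and \<open>y \<in> Q\<close> with \<open>P \<noteq> Q\<close>, then \<open>e\<^sub>P\<close> annihilates \<open>x\<close>,
  \<open>e\<^sub>Q\<close> annihilates \<open>y\<close>, and \<open>e\<^sub>P e\<^sub>Q = 0\<close>, so \<open>x\<close> and \<open>y\<close> are adjacent. The only remaining case is that
  \<open>x\<close> and \<open>y\<close> lie in one and the same minimal prime \<open>P\<close> and in no other; then every element that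
  annihilates one of them lies in all minimal primes but possibly \<open>P\<close>, so that the product of two
  nonzero such elements avoids \<open>P\<close>, and \<open>x\<close> and \<open>y\<close> are not adjacent. Hence two distinct vertices fail to be adjacent exactly when they lie
  in a common set \<open>\<gamma>\<^sub>P\<close>, and the sets \<open>\<gamma>\<^sub>P\<close> are disjoint
  (\<open>weakly_zero_divisor_graph_multipartite\<close>).

  In such a graph with vertex set \<open>V\<close> only two vertices of one part \<open>P\<close> can be separated, and for
  that their common neighbours, which form \<open>V - P\<close>, must all be removed. So the cut-sets are the
  complements of the parts with at least two points (\<open>cut_set_iff\<close>). Each of them is the
  neighbourhood of any vertex of its part, so its size is a degree. The remaining degrees belong to
  vertices adjacent to all others, and these are at least as large as the degrees in a part with two
  points; the hypothesis on \<open>alpha_max\<close> provides such a part. The two minima therefore agree, for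
  infinite rings as well (\<open>vertex_connectivity_eq_min_degree\<close>).
\<close>

section \<open>Complete multipartite graphs\<close>

text \<open>
  The parts need not cover the vertex set: a vertex outside all of them is adjacent to every
  other vertex and forms a singleton part of its own. In the application these are the nonzero
  elements that lie in several minimal primes. Parts are required to be proper so that two vertices
  of one part have a common neighbour, which makes the graph connected.
\<close>

locale multipartite_graph =
  fixes G :: "'a pair_pre_digraph" and parts :: "'a set set"
  assumes parcs_eq: "parcs G = {(x, y). x \<in> pverts G \<and> y \<in> pverts G \<and> x \<noteq> y \<and>
      \<not> (\<exists>P\<in>parts. x \<in> P \<and> y \<in> P)}"
    and parts_disjoint: "pairwise disjnt parts"
    and part_proper: "P \<in> parts \<Longrightarrow> P \<subset> pverts G"
begin

lemma wf: "wf_digraph (with_proj G)"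
  unfolding wf_digraph_wp_iff pair_wf_digraph_def parcs_eq by simp

lemma arc_iff:
  "(x, y) \<in> parcs G \<longleftrightarrow>
    x \<in> pverts G \<and> y \<in> pverts G \<and> x \<noteq> y \<and> \<not> (\<exists>P\<in>parts. x \<in> P \<and> y \<in> P)"
  by (simp add: parcs_eq)

lemma part_unique: "P = Q" if "P \<in> parts" "Q \<in> parts" "x \<in> P" "x \<in> Q"
  using that parts_disjoint unfolding pairwise_def disjnt_def by blast

lemma arc_outside_part:
  assumes "P \<in> parts" "x \<in> P" "v \<in> pverts G - P"
  shows "(x, v) \<in> parcs G" "(v, x) \<in> parcs G"
  using assms part_unique part_proper unfolding arc_iff by blast+

lemma connected_multipartite:
  assumes "pverts G \<noteq> {}"
  shows "connected (with_proj G)"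
proof -
  have "(u, v) \<in> rtrancl_on (pverts G) ((parcs G)\<^sup>s)" if uv: "u \<in> pverts G" "v \<in> pverts G" for u v
  proof -
    have step: "(a, b) \<in> rtrancl_on (pverts G) ((parcs G)\<^sup>s)" if "(a, b) \<in> parcs G" for a b
      using that by (intro rtrancl_on_into_rtrancl_on[OF rtrancl_on_refl]) (auto simp: symcl_def arc_iff)
    consider "u = v" | "(u, v) \<in> parcs G" | P where "P \<in> parts" "u \<in> P" "v \<in> P"
      using uv unfolding arc_iff by blast
    then show ?thesis
    proof cases
      case 1
      then show ?thesis using uv by (auto intro: rtrancl_on_refl)
    next
      case 2
      then show ?thesis by (rule step)
    next
      case 3
      then obtain w where "w \<in> pverts G - P" using part_proper by blast
      then show ?thesis
        using 3 arc_outside_part rtrancl_on_trans[OF step step] by blast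
    qed
  qed
  then show ?thesis
    using assms by (simp add: connected_conv)
qed

text \<open>
  Two vertices can only be separated if they lie in a common part, and then everything outside
  that part is a common neighbour of both; conversely, once all of these are gone the part is
  an independent set.
\<close>

lemma separates_iff:
  "separates G A \<longleftrightarrow> A \<subseteq> pverts G \<and>
    (\<exists>P\<in>parts. pverts G - P \<subseteq> A \<and> (\<exists>x\<in>P - A. \<exists>y\<in>P - A. x \<noteq> y))"
proof
  interpret wf_digraph "with_proj G" by (rule wf)
  assume "separates G A"
  then obtain x y where A: "A \<subseteq> pverts G" and xy: "x \<in> pverts G - A" "y \<in> pverts G - A" "x \<noteq> y"
    and sep: "\<And>p. apath x p y \<Longrightarrow> set (awalk_verts x p) \<inter> A \<noteq> {}"
    unfolding separates_def by blast
  have "(x, y) \<notin> parcs G"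
  proof
    assume "(x, y) \<in> parcs G"
    then have "apath x [(x, y)] y" using xy by (auto simp: apath_simps)
    from sep[OF this] show False using xy by auto
  qed
  then obtain P where P: "P \<in> parts" "x \<in> P" "y \<in> P" using xy by (auto simp: arc_iff)
  have "v \<in> A" if v: "v \<in> pverts G - P" for v
  proof -
    have "apath x [(x, v), (v, y)] y"
      using v xy P arc_outside_part[OF P(1)] by (auto simp: apath_simps)
    from sep[OF this] show ?thesis using xy by auto
  qed
  then show "A \<subseteq> pverts G \<and> (\<exists>P\<in>parts. pverts G - P \<subseteq> A \<and> (\<exists>x\<in>P - A. \<exists>y\<in>P - A. x \<noteq> y))"
    using A P xy by blast
next
  interpret wf_digraph "with_proj G" by (rule wf)
  assume "A \<subseteq> pverts G \<and> (\<exists>P\<in>parts. pverts G - P \<subseteq> A \<and> (\<exists>x\<in>P - A. \<exists>y\<in>P - A. x \<noteq> y))"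
  then obtain P x y where A: "A \<subseteq> pverts G" and P: "P \<in> parts" "pverts G - P \<subseteq> A"
    and xy: "x \<in> P - A" "y \<in> P - A" "x \<noteq> y" by blast
  have "set (awalk_verts x p) \<inter> A \<noteq> {}" if p: "apath x p y" for p
  proof (cases p)
    case Nil
    then show ?thesis using p xy by (auto simp: apath_simps)
  next
    case (Cons e es)
    \<comment> \<open>The second vertex of the path is a neighbour of \<open>x\<close>, hence outside the part.\<close>
    then have e: "(x, snd e) \<in> parcs G" and es: "apath (snd e) es y"
      using p by (auto simp: apath_simps)
    from e have "snd e \<in> A" using P xy by (auto simp: arc_iff)
    moreover have "snd e \<in> set (awalk_verts x p)"
      using hd_in_awalk_verts(2)[OF es] Cons by simp
    ultimately show ?thesis by blast
  qed
  then show "separates G A"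
    unfolding separates_def using A P xy part_proper[OF P(1)] by blast
qed

text \<open>
  Complements of parts are incomparable if the parts are nonempty, because distinct parts are
  disjoint; thus each separating set of this shape is minimal.
\<close>

lemma cut_set_iff:
  "cut_set G A \<longleftrightarrow> (\<exists>P\<in>parts. (\<exists>x\<in>P. \<exists>y\<in>P. x \<noteq> y) \<and> A = pverts G - P)"
proof
  assume cut: "cut_set G A"
  then obtain P x y where P: "P \<in> parts" "pverts G - P \<subseteq> A" and xy: "x \<in> P" "y \<in> P" "x \<noteq> y"
    unfolding cut_set_def separates_iff by blast
  then have "separates G (pverts G - P)" unfolding separates_iff by blast
  then have "A = pverts G - P" using cut P unfolding cut_set_def by blast
  then show "\<exists>P\<in>parts. (\<exists>x\<in>P. \<exists>y\<in>P. x \<noteq> y) \<and> A = pverts G - P" using P xy by blast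
next
  assume "\<exists>P\<in>parts. (\<exists>x\<in>P. \<exists>y\<in>P. x \<noteq> y) \<and> A = pverts G - P"
  then obtain P x y where P: "P \<in> parts" "A = pverts G - P" and xy: "x \<in> P" "y \<in> P" "x \<noteq> y"
    by blast
  have "\<not> separates G B" if B: "B \<subset> A" for B
  proof
    assume "separates G B"
    then obtain Q where Q: "Q \<in> parts" "pverts G - Q \<subseteq> B" unfolding separates_iff by blast
    \<comment> \<open>If \<open>B\<close> contains the complement of \<open>Q\<close> and misses the point \<open>x\<close> of \<open>P\<close>, then \<open>x\<close> lies in
      both parts, so that \<open>B\<close> already contains \<open>A\<close>.\<close>
    then have "x \<in> Q" using B P xy part_proper[OF P(1)] by blast
    then have "Q = P" using P Q xy part_unique by blast
    then show False using B P Q by blast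
  qed
  moreover have "separates G A" unfolding separates_iff using P xy by blast
  moreover have "connected (with_proj G)"
    using connected_multipartite P xy part_proper by blast
  ultimately show "cut_set G A" unfolding cut_set_def by blast
qed

lemma neighbours_in_part:
  assumes "P \<in> parts" "v \<in> P"
  shows "{u \<in> pverts G. (v, u) \<in> parcs G} = pverts G - P"
proof (intro equalityI subsetI)
  fix u assume "u \<in> {u \<in> pverts G. (v, u) \<in> parcs G}"
  then show "u \<in> pverts G - P" using assms arc_iff by blast
next
  fix u assume "u \<in> pverts G - P"
  then show "u \<in> {u \<in> pverts G. (v, u) \<in> parcs G}"
    using arc_outside_part(1)[OF assms] by blast
qed

text \<open>
  Every cut-set is a neighbourhood, which bounds the minimum degree by the connectivity. For the
  other direction only the vertices adjacent to all others need an argument, since the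
  neighbourhoods of all remaining vertices are cut-sets.
\<close>

lemma vertex_connectivity_eq_min_degree:
  assumes big: "P \<in> parts" "x \<in> P" "y \<in> P" "x \<noteq> y"
  shows "vertex_connectivity G =o min_degree G"
proof -
  let ?K = "{|A| | A. cut_set G A}" and ?D = "{vertex_degree G v | v. v \<in> pverts G}"
  have cutP: "cut_set G (pverts G - P)" using big unfolding cut_set_iff by blast
  have vx: "x \<in> pverts G" using big part_proper by blast
  have K: "vertex_connectivity G \<in> ?K" "\<And>s. s \<in> ?K \<Longrightarrow> vertex_connectivity G \<le>o s"
  proof -
    have "?K \<noteq> {}" "\<And>r. r \<in> ?K \<Longrightarrow> Card_order r" using cutP card_of_Card_order by blast+
    from least_card[OF this]
    show "vertex_connectivity G \<in> ?K" "\<And>s. s \<in> ?K \<Longrightarrow> vertex_connectivity G \<le>o s"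
      unfolding vertex_connectivity_def by blast+
  qed
  have D: "min_degree G \<in> ?D" "\<And>s. s \<in> ?D \<Longrightarrow> min_degree G \<le>o s"
  proof -
    have "?D \<noteq> {}" using vx by blast
    moreover have "Card_order r" if "r \<in> ?D" for r
      using that card_of_Card_order unfolding vertex_degree_def by fast
    ultimately have "?D \<noteq> {}" "\<And>r. r \<in> ?D \<Longrightarrow> Card_order r" by blast+
    from least_card[OF this]
    show "min_degree G \<in> ?D" "\<And>s. s \<in> ?D \<Longrightarrow> min_degree G \<le>o s"
      unfolding min_degree_def by blast+
  qed
  have "min_degree G \<le>o vertex_connectivity G"
  proof -
    from K(1) obtain A where A: "vertex_connectivity G = |A|" "cut_set G A" by blast
    then obtain Q v where Q: "Q \<in> parts" "v \<in> Q" "A = pverts G - Q"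
      unfolding cut_set_iff by blast
    then have "vertex_degree G v = |A|" by (simp add: vertex_degree_def neighbours_in_part)
    moreover have "v \<in> pverts G" using Q part_proper by blast
    ultimately have "|A| \<in> ?D" by force
    then show ?thesis using D(2) A(1) by simp
  qed
  moreover have "vertex_connectivity G \<le>o min_degree G"
  proof -
    from D(1) obtain v where v: "v \<in> pverts G" and Dv: "min_degree G = vertex_degree G v"
      by blast
    show ?thesis
    proof (cases "\<exists>Q\<in>parts. v \<in> Q \<and> (\<exists>a\<in>Q. \<exists>b\<in>Q. a \<noteq> b)")
      case True
      then obtain Q where Q: "Q \<in> parts" "v \<in> Q" "cut_set G (pverts G - Q)"
        unfolding cut_set_iff by blast
      then show ?thesis
        using K(2) Dv by (auto simp: vertex_degree_def neighbours_in_part)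
    next
      case False
      then have nb: "{u \<in> pverts G. (v, u) \<in> parcs G} = pverts G - {v}"
        using v by (auto simp: arc_iff)
      have "v \<notin> P" using False big by blast
      \<comment> \<open>The complement of \<open>P\<close> contains \<open>v\<close> but not \<open>x\<close>; sending \<open>v\<close> to \<open>x\<close> embeds it into the
        complement of \<open>v\<close>, without any subtraction of cardinals.\<close>
      let ?f = "\<lambda>u. if u = v then x else u"
      have "inj_on ?f (pverts G - P)" using big by (auto simp: inj_on_def)
      moreover have "?f ` (pverts G - P) \<subseteq> pverts G - {v}"
        using vx big \<open>v \<notin> P\<close> by auto
      ultimately have "|pverts G - P| \<le>o |pverts G - {v}|"
        using card_of_ordLeq by blast
      moreover have "vertex_connectivity G \<le>o |pverts G - P|" using K(2) cutP by blast
      ultimately show ?thesis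
        using Dv nb ordLeq_transitive by (simp add: vertex_degree_def) blast
    qed
  qed
  ultimately show ?thesis by (simp add: ordIso_iff_ordLeq)
qed

end

section \<open>Minimal primes of a reduced ring\<close>

context cring
begin

text \<open>
  Complements of minimal primes are the maximal multiplicatively closed sets without \<open>0\<close>. Because
  \<open>x\<close> is not nilpotent, its powers form such a set, and Zorn's lemma enlarges it to a maximal one,
  \<open>S\<close>. By maximality any \<open>r \<notin> S\<close> satisfies \<open>s r\<^sup>k = 0\<close> for some \<open>s \<in> S\<close>, and as the ring is reduced
  already \<open>s r = 0\<close>. So the complement of \<open>S\<close> consists of the elements killed by some member of \<open>S\<close>,
  a description that makes it an ideal.
\<close>

lemma ex_minimal_prime_avoiding:
  assumes red: "reduced_ring R" and x: "x \<in> carrier R" "x \<noteq> \<zero>"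
  shows "\<exists>P\<in>minimal_primes R. x \<notin> P"
proof -
  define \<S> where "\<S> = {S. S \<subseteq> carrier R \<and> \<one> \<in> S \<and> x \<in> S \<and> \<zero> \<notin> S \<and> (\<forall>a\<in>S. \<forall>b\<in>S. a \<otimes> b \<in> S)}"
  have "\<exists>S\<in>\<S>. \<forall>T\<in>\<S>. S \<subseteq> T \<longrightarrow> T = S"
  proof (rule subset_Zorn_nonempty)
    have "{x [^] k |k::nat. True} \<in> \<S>"
    proof -
      have "\<one> = x [^] (0::nat)" "x = x [^] (1::nat)" using x by auto
      moreover have "\<zero> \<noteq> x [^] (k::nat)" for k
        using red x by (metis reduced_ring_def)
      moreover have "\<exists>l. x [^] j \<otimes> x [^] k = x [^] (l::nat)" for j k :: nat
        using x nat_pow_mult by blast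
      ultimately show ?thesis unfolding \<S>_def using x by blast
    qed
    then show "\<S> \<noteq> {}" by blast
  next
    fix C assume C: "C \<noteq> {}" "subset.chain \<S> C"
    have "a \<otimes> b \<in> \<Union>C" if "a \<in> \<Union>C" "b \<in> \<Union>C" for a b
    proof -
      from that obtain S T where S: "S \<in> C" "T \<in> C" "a \<in> S" "b \<in> T" by blast
      then have "S \<subseteq> T \<or> T \<subseteq> S" "S \<in> \<S>" "T \<in> \<S>" using C unfolding subset_chain_def by blast+
      then show ?thesis using S unfolding \<S>_def by blast
    qed
    moreover have C_S: "S \<subseteq> carrier R" "\<one> \<in> S" "x \<in> S" "\<zero> \<notin> S" if "S \<in> C" for S
      using that C(2) unfolding subset_chain_def \<S>_def by auto
    moreover obtain S where "S \<in> C" using C(1) by blast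
    ultimately have "\<Union>C \<subseteq> carrier R" "\<one> \<in> \<Union>C" "x \<in> \<Union>C" "\<zero> \<notin> \<Union>C"
      "\<forall>a\<in>\<Union>C. \<forall>b\<in>\<Union>C. a \<otimes> b \<in> \<Union>C"
      by blast+
    then show "\<Union>C \<in> \<S>" unfolding \<S>_def by simp
  qed
  then obtain S where S: "S \<in> \<S>" and max: "\<And>T. T \<in> \<S> \<Longrightarrow> S \<subseteq> T \<Longrightarrow> T = S" by blast
  have sub: "S \<subseteq> carrier R" and one: "\<one> \<in> S" and xS: "x \<in> S" and zero: "\<zero> \<notin> S"
    and mult: "\<And>a b. a \<in> S \<Longrightarrow> b \<in> S \<Longrightarrow> a \<otimes> b \<in> S"
    using S unfolding \<S>_def by auto
  have killed: "r \<notin> S \<longleftrightarrow> (\<exists>s\<in>S. s \<otimes> r = \<zero>)" if r: "r \<in> carrier R" for r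
  proof
    assume rS: "r \<notin> S"
    \<comment> \<open>\<open>T\<close> is the multiplicatively closed set generated by \<open>S\<close> and \<open>r\<close>.\<close>
    define T where "T = {s \<otimes> r [^] k |s (k::nat). s \<in> S}"
    have T: "s \<otimes> r [^] (k::nat) \<in> T" if "s \<in> S" for s k using that unfolding T_def by blast
    have S_sub: "S \<subseteq> T"
    proof
      fix s assume "s \<in> S"
      then show "s \<in> T" using T[of s 0] sub by auto
    qed
    have rT: "r \<in> T" using T[OF one, of 1] r by simp
    have "\<zero> \<in> T"
    proof (rule ccontr)
      assume "\<zero> \<notin> T"
      moreover have "a \<otimes> b \<in> T" if "a \<in> T" "b \<in> T" for a b
      proof -
        from that obtain s k s' k' where ab: "s \<in> S" "s' \<in> S"
          "a = s \<otimes> r [^] (k::nat)" "b = s' \<otimes> r [^] (k'::nat)" unfolding T_def by blast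
        have "a \<otimes> b = (s \<otimes> s') \<otimes> (r [^] k \<otimes> r [^] k')"
          using ab sub r by (simp add: m_ac subsetD)
        also have "\<dots> = (s \<otimes> s') \<otimes> r [^] (k + k')" using r by (simp add: nat_pow_mult)
        finally show ?thesis using T mult ab by auto
      qed
      moreover have "T \<subseteq> carrier R" unfolding T_def using sub r by auto
      ultimately have "T \<in> \<S>" unfolding \<S>_def using S_sub one xS by blast
      then show False using max S_sub rT rS by blast
    qed
    then obtain s k where s: "s \<in> S" "s \<otimes> r [^] (k::nat) = \<zero>" unfolding T_def by auto
    have sc: "s \<in> carrier R" using s sub by blast
    have "(s \<otimes> r) [^] Suc k = (s [^] k \<otimes> r) \<otimes> (s \<otimes> r [^] k)"
      using sc r by (simp add: nat_pow_distrib m_ac)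
    also have "\<dots> = \<zero>" using s sc r by simp
    finally have "s \<otimes> r = \<zero>" using red sc r unfolding reduced_ring_def by blast
    then show "\<exists>s\<in>S. s \<otimes> r = \<zero>" using s by blast
  next
    assume "\<exists>s\<in>S. s \<otimes> r = \<zero>"
    then show "r \<notin> S" using mult zero by metis
  qed
  let ?P = "carrier R - S"
  have absorb: "a \<otimes> b \<in> ?P" if a: "a \<in> ?P" and b: "b \<in> carrier R" for a b
  proof -
    from a killed obtain s where s: "s \<in> S" "s \<otimes> a = \<zero>" by blast
    then have "s \<otimes> (a \<otimes> b) = \<zero>" using a b sub by (simp add: m_assoc[symmetric] subsetD)
    then show ?thesis using a b s killed[of "a \<otimes> b"] by blast
  qed
  have prime: "primeideal ?P R"
  proof (rule primeidealI[OF idealI])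
    show "subgroup ?P (add_monoid R)"
    proof (rule add.subgroupI)
      show "?P \<noteq> {}" using zero by blast
      show "\<ominus> a \<in> ?P" if "a \<in> ?P" for a
        using absorb[OF that, of "\<ominus> \<one>"] that by (simp add: r_minus)
      show "a \<oplus> b \<in> ?P" if a: "a \<in> ?P" and b: "b \<in> ?P" for a b
      proof -
        from a b killed obtain s t where s: "s \<in> S" "s \<otimes> a = \<zero>" and t: "t \<in> S" "t \<otimes> b = \<zero>"
          by blast
        have c: "s \<in> carrier R" "t \<in> carrier R" "a \<in> carrier R" "b \<in> carrier R"
          using s t a b sub by auto
        have "(s \<otimes> t) \<otimes> (a \<oplus> b) = t \<otimes> (s \<otimes> a) \<oplus> s \<otimes> (t \<otimes> b)"
          using c by (simp add: r_distr m_ac)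
        also have "\<dots> = \<zero>" using s t c by simp
        finally show ?thesis using killed[of "a \<oplus> b"] mult s t c by blast
      qed
    qed auto
    show "carrier R \<noteq> ?P" using one by blast
    show "a \<in> ?P \<or> b \<in> ?P" if "a \<in> carrier R" "b \<in> carrier R" "a \<otimes> b \<in> ?P" for a b
      using that mult by blast
  qed (use absorb m_comm in \<open>auto intro: is_cring ring_axioms\<close>)
  \<comment> \<open>A smaller prime would have a larger multiplicatively closed complement.\<close>
  have "Q = ?P" if Q: "primeideal Q R" "Q \<subseteq> ?P" for Q
  proof -
    interpret Q: primeideal Q R by (rule Q)
    have "\<one> \<notin> Q" using Q one by blast
    moreover have "a \<otimes> b \<notin> Q" if "a \<in> carrier R - Q" "b \<in> carrier R - Q" for a b
      using that Q.I_prime by blast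
    ultimately have "carrier R - Q \<in> \<S>"
      unfolding \<S>_def using Q(2) xS x by auto
    then have "carrier R - Q = S" using max Q(2) sub by blast
    then show ?thesis using Q(2) by blast
  qed
  then have "?P \<in> minimal_primes R" using prime unfolding minimal_primes_def by blast
  then show ?thesis using xS by blast
qed

lemma minimal_prime_ideal:
  assumes "P \<in> minimal_primes R"
  shows "primeideal P R"
  using assms unfolding minimal_primes_def by blast

text \<open>
  Minimal primes are pairwise incomparable, so each member of \<open>F\<close> contains an element outside \<open>P\<close>;
  the product of these elements stays outside the prime \<open>P\<close>.
\<close>

lemma ex_in_other_minimal_primes:
  assumes "finite F" "F \<subseteq> minimal_primes R" "P \<in> minimal_primes R" "P \<notin> F"
  shows "\<exists>e\<in>carrier R. e \<notin> P \<and> (\<forall>Q\<in>F. e \<in> Q)"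
  using assms
proof (induction F rule: finite_induct)
  case empty
  interpret P: primeideal P R using empty minimal_prime_ideal by blast
  have "\<one> \<notin> P" using P.one_imp_carrier P.I_notcarr by blast
  then show ?case by blast
next
  case (insert Q F)
  interpret P: primeideal P R using insert minimal_prime_ideal by blast
  interpret Q: primeideal Q R using insert minimal_prime_ideal by blast
  obtain e where e: "e \<in> carrier R" "e \<notin> P" "\<forall>I\<in>F. e \<in> I" using insert by blast
  have "\<not> Q \<subseteq> P" using insert Q.primeideal unfolding minimal_primes_def by blast
  then obtain q where q: "q \<in> Q" "q \<notin> P" by blast
  have qc: "q \<in> carrier R" using q Q.a_Hcarr by blast
  have "e \<otimes> q \<in> I" if "I \<in> insert Q F" for I
  proof (cases "I = Q")
    case True
    then show ?thesis using Q.I_l_closed q e by blast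
  next
    case False
    then have I: "I \<in> F" "I \<in> minimal_primes R" using that insert by auto
    then interpret I: primeideal I R using minimal_prime_ideal by blast
    show ?thesis using I.I_r_closed e qc I by blast
  qed
  moreover have "e \<otimes> q \<notin> P" using P.I_prime e q qc by blast
  ultimately show ?case using e qc by blast
qed

lemma eq_zero_iff_in_minimal_primes:
  assumes "reduced_ring R" "a \<in> carrier R"
  shows "a = \<zero> \<longleftrightarrow> (\<forall>P\<in>minimal_primes R. a \<in> P)"
proof
  assume "a = \<zero>"
  moreover have "\<zero> \<in> P" if "P \<in> minimal_primes R" for P
  proof -
    interpret P: primeideal P R using that minimal_prime_ideal by blast
    show ?thesis by (rule P.zero_closed)
  qed
  ultimately show "\<forall>P\<in>minimal_primes R. a \<in> P" by blast
next
  assume "\<forall>P\<in>minimal_primes R. a \<in> P"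
  then show "a = \<zero>" using ex_minimal_prime_avoiding assms by blast
qed

lemma mult_in_minimal_prime_iff:
  assumes "P \<in> minimal_primes R" "a \<in> carrier R" "b \<in> carrier R"
  shows "a \<otimes> b \<in> P \<longleftrightarrow> a \<in> P \<or> b \<in> P"
proof -
  interpret P: primeideal P R using assms minimal_prime_ideal by blast
  show ?thesis
  proof
    assume "a \<in> P \<or> b \<in> P"
    then show "a \<otimes> b \<in> P" using P.I_r_closed[OF _ assms(3)] P.I_l_closed[OF _ assms(2)] by blast
  qed (rule P.I_prime[OF assms(2,3)])
qed

lemma mult_eq_zero_iff:
  assumes "reduced_ring R" "a \<in> carrier R" "b \<in> carrier R"
  shows "a \<otimes> b = \<zero> \<longleftrightarrow> (\<forall>P\<in>minimal_primes R. a \<in> P \<or> b \<in> P)"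
  using assms eq_zero_iff_in_minimal_primes mult_in_minimal_prime_iff by simp

section \<open>The weakly zero-divisor graph\<close>

lemma in_zero_divisors_iff:
  assumes red: "reduced_ring R" and fin: "finite (minimal_primes R)"
  shows "x \<in> zero_divisors R \<longleftrightarrow> x \<in> carrier R \<and> (\<exists>P\<in>minimal_primes R. x \<in> P)"
proof
  assume "x \<in> zero_divisors R"
  then obtain y where xy: "x \<in> carrier R" "y \<in> carrier R" "y \<noteq> \<zero>" "x \<otimes> y = \<zero>"
    unfolding zero_divisors_def by blast
  then obtain P where "P \<in> minimal_primes R" "y \<notin> P"
    using ex_minimal_prime_avoiding[OF red] by blast
  moreover from this have "x \<in> P" using mult_eq_zero_iff[OF red xy(1,2)] xy(4) by blast
  ultimately show "x \<in> carrier R \<and> (\<exists>P\<in>minimal_primes R. x \<in> P)" using xy(1) by blast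
next
  assume x: "x \<in> carrier R \<and> (\<exists>P\<in>minimal_primes R. x \<in> P)"
  then obtain P where P: "P \<in> minimal_primes R" "x \<in> P" by blast
  obtain e where e: "e \<in> carrier R" "e \<notin> P" "\<forall>Q\<in>minimal_primes R - {P}. e \<in> Q"
    using ex_in_other_minimal_primes[of "minimal_primes R - {P}" P] fin P by auto
  have "\<forall>Q\<in>minimal_primes R. x \<in> Q \<or> e \<in> Q" using e(3) P(2) by blast
  then have "x \<otimes> e = \<zero>" using mult_eq_zero_iff[OF red] x e(1) by simp
  moreover have "e \<noteq> \<zero>" using eq_zero_iff_in_minimal_primes[OF red e(1)] P(1) e(2) by blast
  ultimately show "x \<in> zero_divisors R" unfolding zero_divisors_def using e(1) x by blast
qed

text \<open>
  An element annihilating \<open>x\<close> must lie in every minimal prime that omits \<open>x\<close>. The best choices are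
  therefore the elements omitted by a single minimal prime, one that contains \<open>x\<close>; two such
  elements have product \<open>0\<close> as soon as the primes omitting them differ.
\<close>

lemma weakly_adjacent_iff:
  assumes red: "reduced_ring R" and fin: "finite (minimal_primes R)"
    and x: "x \<in> zero_divisors R" and y: "y \<in> zero_divisors R"
  shows "(\<exists>w\<in>ann R x. \<exists>z\<in>ann R y. w \<noteq> \<zero> \<and> z \<noteq> \<zero> \<and> w \<otimes> z = \<zero>) \<longleftrightarrow>
    \<not> (\<exists>P\<in>minimal_primes R. x \<in> gamma_part R P \<and> y \<in> gamma_part R P)"
    (is "?adj \<longleftrightarrow> ?diff_parts")
proof
  assume ?adj
  then obtain w z where wz: "w \<in> ann R x" "z \<in> ann R y" "w \<noteq> \<zero>" "z \<noteq> \<zero>" "w \<otimes> z = \<zero>" by blast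
  have c: "w \<in> carrier R" "z \<in> carrier R" "x \<in> carrier R" "y \<in> carrier R"
    using wz x y unfolding ann_def zero_divisors_def by auto
  have eqs: "w \<otimes> x = \<zero>" "z \<otimes> y = \<zero>" using wz unfolding ann_def by auto
  show ?diff_parts
  proof
    assume "\<exists>P\<in>minimal_primes R. x \<in> gamma_part R P \<and> y \<in> gamma_part R P"
    then obtain P where P: "P \<in> minimal_primes R" "x \<in> gamma_part R P" "y \<in> gamma_part R P"
      by blast
    \<comment> \<open>Being nonzero, \<open>w\<close> and \<open>z\<close> must avoid \<open>P\<close>, since they lie in all other minimal primes.\<close>
    have "w \<in> Q \<and> z \<in> Q" if "Q \<in> minimal_primes R" "Q \<noteq> P" for Q
    proof -
      have "x \<notin> Q" "y \<notin> Q" using that P(2,3) unfolding gamma_part_def by auto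
      moreover have "w \<in> Q \<or> x \<in> Q" using mult_eq_zero_iff[OF red c(1,3)] eqs(1) that(1) by simp
      moreover have "z \<in> Q \<or> y \<in> Q" using mult_eq_zero_iff[OF red c(2,4)] eqs(2) that(1) by simp
      ultimately show ?thesis by blast
    qed
    moreover have "\<exists>Q\<in>minimal_primes R. w \<notin> Q" "\<exists>Q\<in>minimal_primes R. z \<notin> Q"
      using ex_minimal_prime_avoiding[OF red] c(1,2) wz(3,4) by simp_all
    ultimately have "w \<notin> P" "z \<notin> P" by blast+
    then show False using mult_eq_zero_iff[OF red c(1,2)] wz(5) P(1) by blast
  qed
next
  assume diff_parts: ?diff_parts
  have c: "x \<in> carrier R" "y \<in> carrier R" using x y unfolding zero_divisors_def by auto
  obtain P Q where PQ: "P \<in> minimal_primes R" "Q \<in> minimal_primes R" "x \<in> P" "y \<in> Q" "P \<noteq> Q"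
  proof -
    obtain P Q where *: "P \<in> minimal_primes R" "Q \<in> minimal_primes R" "x \<in> P" "y \<in> Q"
      using x y in_zero_divisors_iff[OF red fin] by blast
    show thesis
    proof (cases "P = Q")
      case True
      then have "x \<notin> gamma_part R P \<or> y \<notin> gamma_part R P" using diff_parts * by blast
      then show thesis using that * True unfolding gamma_part_def by blast
    qed (use that * in blast)
  qed
  have ex: "\<exists>e\<in>carrier R. e \<notin> I \<and> (\<forall>J\<in>minimal_primes R - {I}. e \<in> J)"
    if "I \<in> minimal_primes R" for I
    using that fin by (intro ex_in_other_minimal_primes) auto
  obtain w where w: "w \<in> carrier R" "w \<notin> P" "\<forall>J\<in>minimal_primes R - {P}. w \<in> J"
    using ex PQ by blast
  obtain z where z: "z \<in> carrier R" "z \<notin> Q" "\<forall>J\<in>minimal_primes R - {Q}. z \<in> J"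
    using ex PQ by blast
  have "\<forall>J\<in>minimal_primes R. w \<in> J \<or> x \<in> J" "\<forall>J\<in>minimal_primes R. z \<in> J \<or> y \<in> J"
    "\<forall>J\<in>minimal_primes R. w \<in> J \<or> z \<in> J"
    using w(3) z(3) PQ by blast+
  then have "w \<otimes> x = \<zero>" "z \<otimes> y = \<zero>" "w \<otimes> z = \<zero>"
    using w z c mult_eq_zero_iff[OF red] by simp_all
  moreover have "w \<noteq> \<zero>" "z \<noteq> \<zero>"
    using eq_zero_iff_in_minimal_primes[OF red w(1)] eq_zero_iff_in_minimal_primes[OF red z(1)]
      w(2) z(2) PQ(1,2) by auto
  ultimately show ?adj using w(1) z(1) unfolding ann_def by blast
qed

text \<open>
  A part \<open>\<gamma>\<^sub>P\<close> is proper because an element lying in all minimal primes except \<open>P\<close> is a vertex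
  outside \<open>P\<close>; it is here that a second minimal prime matters.
\<close>

lemma weakly_zero_divisor_graph_multipartite:
  assumes red: "reduced_ring R" and fin: "finite (minimal_primes R)"
    and two: "2 \<le> card (minimal_primes R)"
  shows "multipartite_graph (weakly_zero_divisor_graph R) (gamma_part R ` minimal_primes R)"
proof
  show "parcs (weakly_zero_divisor_graph R) =
    {(x, y). x \<in> pverts (weakly_zero_divisor_graph R) \<and> y \<in> pverts (weakly_zero_divisor_graph R) \<and>
      x \<noteq> y \<and> \<not> (\<exists>P\<in>gamma_part R ` minimal_primes R. x \<in> P \<and> y \<in> P)}"
    using weakly_adjacent_iff[OF red fin] by (auto simp: weakly_zero_divisor_graph_def)
  show "pairwise disjnt (gamma_part R ` minimal_primes R)"
    unfolding pairwise_def disjnt_def gamma_part_def by blast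
  fix \<gamma> assume "\<gamma> \<in> gamma_part R ` minimal_primes R"
  then obtain P where P: "P \<in> minimal_primes R" "\<gamma> = gamma_part R P" by blast
  have "minimal_primes R \<noteq> {P}" using two by auto
  then obtain Q where Q: "Q \<in> minimal_primes R" "Q \<noteq> P" using P by blast
  have vertex: "a \<in> pverts (weakly_zero_divisor_graph R)"
    if a: "a \<in> carrier R" "I \<in> minimal_primes R" "J \<in> minimal_primes R" "a \<in> I" "a \<notin> J" for a I J
  proof -
    have "a \<in> zero_divisors R" using in_zero_divisors_iff[OF red fin] a(1,2,4) by blast
    moreover have "a \<noteq> \<zero>" using eq_zero_iff_in_minimal_primes[OF red a(1)] a(3,5) by blast
    ultimately show ?thesis by (simp add: weakly_zero_divisor_graph_def)
  qed
  interpret P: primeideal P R using P(1) minimal_prime_ideal by blast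
  have "\<gamma> \<subseteq> pverts (weakly_zero_divisor_graph R)"
  proof
    fix a assume "a \<in> \<gamma>"
    then have "a \<in> P" "a \<notin> Q" using P(2) Q unfolding gamma_part_def by auto
    then show "a \<in> pverts (weakly_zero_divisor_graph R)" using vertex P(1) Q(1) P.a_Hcarr by blast
  qed
  moreover obtain e where e: "e \<in> carrier R" "e \<notin> P" "\<forall>I\<in>minimal_primes R - {P}. e \<in> I"
    using ex_in_other_minimal_primes[of "minimal_primes R - {P}" P] fin P by auto
  then have "e \<in> pverts (weakly_zero_divisor_graph R)" using vertex P(1) Q by blast
  then have "\<gamma> \<noteq> pverts (weakly_zero_divisor_graph R)"
    using e P unfolding gamma_part_def by blast
  ultimately show "\<gamma> \<subset> pverts (weakly_zero_divisor_graph R)" by blast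
qed

end

text \<open>
  The greatest cardinality is attained because there are only finitely many minimal primes.
\<close>

lemma ex_gamma_part_with_two_elements:
  assumes fin: "finite (minimal_primes R)" and "minimal_primes R \<noteq> {}"
    and "ctwo \<le>o alpha_max R"
  obtains P x y where "P \<in> minimal_primes R" "x \<in> gamma_part R P" "y \<in> gamma_part R P" "x \<noteq> y"
proof -
  have "finite {|gamma_part R P| | P. P \<in> minimal_primes R}"
    using fin by simp
  then have "alpha_max R \<in> {|gamma_part R P| | P. P \<in> minimal_primes R}"
    unfolding alpha_max_def
  proof (rule greatest_card(1))
    show "{|gamma_part R P| | P. P \<in> minimal_primes R} \<noteq> {}" using assms(2) by blast
    show "Card_order r" if "r \<in> {|gamma_part R P| | P. P \<in> minimal_primes R}" for r
      using that card_of_Card_order by fast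
  qed
  then obtain P where P: "P \<in> minimal_primes R" "alpha_max R = |gamma_part R P|" by blast
  then have "|UNIV :: bool set| \<le>o |gamma_part R P|" using assms(3) by (simp add: ctwo_def)
  then obtain f :: "bool \<Rightarrow> 'a" where "inj f" "range f \<subseteq> gamma_part R P"
    unfolding card_of_ordLeq[symmetric] by blast
  then show thesis using that[OF P(1), of "f True" "f False"] by (auto simp: inj_def)
qed

theorem theorem3p4:
  fixes R :: "('a, 'm) ring_scheme" and n :: nat
  assumes "cring R"
    and "reduced_ring R"
    and "card (minimal_primes R) = n"
    and "3 \<le> n"
    and "ctwo \<le>o alpha_max R"
  shows "vertex_connectivity (weakly_zero_divisor_graph R) =o
    min_degree (weakly_zero_divisor_graph R)"
proof -
  interpret cring R by fact
  have fin: "finite (minimal_primes R)" and ne: "minimal_primes R \<noteq> {}"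
    using assms(3,4) by (auto intro: card_ge_0_finite)
  interpret multipartite_graph "weakly_zero_divisor_graph R" "gamma_part R ` minimal_primes R"
    using weakly_zero_divisor_graph_multipartite assms fin by simp
  obtain P x y where "P \<in> minimal_primes R" "x \<in> gamma_part R P" "y \<in> gamma_part R P" "x \<noteq> y"
    using ex_gamma_part_with_two_elements[OF fin ne assms(5)] by blast
  then show ?thesis using vertex_connectivity_eq_min_degree by blast
qed

end
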